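(* Consider the noise-intervened Hegselmann–Krause system described in the context, with $n$ agents, confidence threshold $\epsilon>0$, divisive initial state, and noise uniformly distributed on $[-\delta_1,\delta_2]$ with $0\le\delta_1\le\delta_2$. Then for any $\epsilon>0$ and any $0<\delta_2\le \frac{\epsilon}{2n}$, the system almost surely reaches $\delta_2$-consensus in finite time; that is, with $T=\inf\{t\ge 0: d_{\mathcal V}(t')\le\delta_2\text{ for all }t'\ge t\}$ one has $P\{T<\infty\}=1$.
   Context: Time $t\in\{0,1,2,\dots\}$ is discrete. Agents are $\mathcal V=\{1,\dots,n\}$, with opinions $x(t)=(x_1(t),\dots,x_n(t))\in\mathbb R^n$. The confidence threshold is $\epsilon>0$, and the neighbor set of agent $i$ is $\mathcal N_i(x(t))=\{j\in\mathcal V: |x_j(t)-x_i(t)|\le\epsilon\}$. Divisive initial state: $\mathcal V$ is partitioned into nonempty disjoint clusters $\mathcal V_1,\dots,\mathcal V_{N_c}$ with $2\le N_c\le n$; there are real numbers $x_1^*,\dots,x_{N_c}^*$ with $x_p^*-x_q^*>\epsilon$ for all $1\le q<p\le N_c$; and $x_i(0)=x_g^*$ for every $i\in\mathcal V_g$, $1\le g\le N_c$. Agent $1$ belongs to $\mathcal V_1$ (the cluster with the smallest opinion value). Dynamics: for all $i\in\mathcal V$ and $t\ge0$, $$x_i(t+1)=\frac{1}{|\mathcal N_i(x(t))|}\sum_{j\in\mathcal N_i(x(t))}x_j(t)+I_{\{i=1\}}\,\xi(t+1),$$ where $I_{\{i=1\}}$ equals $1$ if $i=1$ and $0$ otherwise,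 and $\{\xi(t),t\ge1\}$ are independent random variables, each uniformly distributed on $[-\delta_1,\delta_2]$, with $0\le\delta_1\le\delta_2$. Notation: $d_{\mathcal V}(t)=\max_{i,j\in\mathcal V}|x_i(t)-x_j(t)|$. *)

theory Defs
  imports "HOL-Probability.Probability"
begin

definition neighbors :: "nat \<Rightarrow> real \<Rightarrow> (nat \<Rightarrow> real) \<Rightarrow> nat \<Rightarrow> nat set" where
  "neighbors n \<epsilon> y i = {j \<in> {1..n}. \<bar>y j - y i\<bar> \<le> \<epsilon>}"

text \<open>Opinion vectors are functions on \<open>nat\<close>; only the values at the agents \<open>{1..n}\<close> matter.
  The argument \<open>w\<close> is one noise path, read at times \<open>1, 2, \<dots>\<close> only.\<close>

primrec HK :: "nat \<Rightarrow> real \<Rightarrow> (nat \<Rightarrow> real) \<Rightarrow> (nat \<Rightarrow> real) \<Rightarrow> nat \<Rightarrow> nat \<Rightarrow> real" where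
  "HK n \<epsilon> x0 w 0 = x0"
| "HK n \<epsilon> x0 w (Suc t) = (\<lambda>i.
     (\<Sum>j\<in>neighbors n \<epsilon> (HK n \<epsilon> x0 w t) i. HK n \<epsilon> x0 w t j)
       / real (card (neighbors n \<epsilon> (HK n \<epsilon> x0 w t) i))
     + (if i = 1 then w (Suc t) else 0))"

definition divisive :: "nat \<Rightarrow> real \<Rightarrow> nat \<Rightarrow> (nat \<Rightarrow> nat set) \<Rightarrow> (nat \<Rightarrow> real) \<Rightarrow> (nat \<Rightarrow> real) \<Rightarrow> bool" where
  "divisive n \<epsilon> Nc V xs x0 \<longleftrightarrow>
     2 \<le> Nc \<and> Nc \<le> n \<and>
     (\<Union>g\<in>{1..Nc}. V g) = {1..n} \<and> disjoint_family_on V {1..Nc} \<and> (\<forall>g\<in>{1..Nc}. V g \<noteq> {}) \<and>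
     (\<forall>p\<in>{1..Nc}. \<forall>q\<in>{1..Nc}. q < p \<longrightarrow> xs p - xs q > \<epsilon>) \<and>
     (\<forall>g\<in>{1..Nc}. \<forall>i\<in>V g. x0 i = xs g) \<and>
     1 \<in> V 1"

definition diam :: "nat \<Rightarrow> (nat \<Rightarrow> real) \<Rightarrow> real" where
  "diam n y = Max {\<bar>y i - y j\<bar> | i j. i \<in> {1..n} \<and> j \<in> {1..n}}"

text \<open>In \<open>enat\<close> the infimum of the empty set is \<open>\<infinity>\<close>.\<close>

definition consensus_time :: "nat \<Rightarrow> real \<Rightarrow> (nat \<Rightarrow> nat \<Rightarrow> real) \<Rightarrow> enat" where
  "consensus_time n \<delta> x = Inf {enat t | t. \<forall>t'\<ge>t. diam n (x t') \<le> \<delta>}"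

end

theory Submission
  imports Defs
begin

text \<open>
  The argument is pathwise apart from one probabilistic input. As long as agent 1 sees none of the
  clusters above it, the agents of its own cluster, of size \<open>m\<close>, share the opinion \<open>a\<close> up to the
  last noise \<open>r\<close> carried by agent 1, and \<open>m a + r\<close> grows by exactly the noise: it is a random walk.
  When agent 1 comes into sight of the next cluster, the bound \<open>2 n \<delta> \<le> \<epsilon>\<close> forces that cluster to be
  pulled into mutual sight of the whole lower cluster within one step, so both merge in two steps
  without agent 1 ever passing the upper one. Hence every noise path whose partial sums are
  unbounded above absorbs all clusters one after the other. Since \<open>\<delta>\<^sub>1 \<le> \<delta>\<^sub>2\<close>, the noise has nonnegative
  mean, and the central limit theorem bounds the probability that the partial sums exceed \<open>K\<close> below by a
  positive constant independent of \<open>K\<close>; by Kolmogorov's 0-1 law they are almost surely unbounded above.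
\<close>

section \<open>Consensus time and diameter as pointwise conditions\<close>

lemma diam_le_iff:
  assumes "n \<ge> 1"
  shows "diam n y \<le> d \<longleftrightarrow> (\<forall>i\<in>{1..n}. \<forall>j\<in>{1..n}. \<bar>y i - y j\<bar> \<le> d)"
proof -
  have eq: "{\<bar>y i - y j\<bar> | i j. i \<in> {1..n} \<and> j \<in> {1..n}} = (\<lambda>(i, j). \<bar>y i - y j\<bar>) ` ({1..n} \<times> {1..n})"
    by (auto simp: image_iff; blast)
  have ne: "{1..n} \<times> {1..n} \<noteq> {}" using assms by auto
  show ?thesis unfolding diam_def eq
    by (subst Max_le_iff) (use ne in auto)
qed

text \<open>Trades the infimum in \<open>enat\<close> for quantifiers over times; both the pathwise
  argument and the measurability of the final event work with this form.\<close>

lemma consensus_time_finite_iff: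
  "consensus_time n d x < \<infinity> \<longleftrightarrow> (\<exists>t. \<forall>t'\<ge>t. diam n (x t') \<le> d)"
proof -
  have "consensus_time n d x < \<infinity> \<longleftrightarrow> {enat t | t. \<forall>t'\<ge>t. diam n (x t') \<le> d} \<noteq> {}"
  proof
    assume "{enat t | t. \<forall>t'\<ge>t. diam n (x t') \<le> d} \<noteq> {}"
    then obtain t where "enat t \<in> {enat t | t. \<forall>t'\<ge>t. diam n (x t') \<le> d}" by blast
    then have "consensus_time n d x \<le> enat t" unfolding consensus_time_def by (rule Inf_lower)
    then show "consensus_time n d x < \<infinity>" using enat_ord_simps(4) order_le_less_trans by blast
  next
    assume "consensus_time n d x < \<infinity>"
    then show "{enat t | t. \<forall>t'\<ge>t. diam n (x t') \<le> d} \<noteq> {}"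
      unfolding consensus_time_def by (metis (lifting) Inf_empty less_irrefl top_enat_def)
  qed
  then show ?thesis by blast
qed

lemma HK_Suc_neighbors:
  assumes "neighbors n \<epsilon> (HK n \<epsilon> x0 w t) i = A"
  shows "HK n \<epsilon> x0 w (Suc t) i =
    (\<Sum>j\<in>A. HK n \<epsilon> x0 w t j) / real (card A) + (if i = 1 then w (Suc t) else 0)"
  using assms by simp

section \<open>Deterministic dynamics along one bounded noise path\<close>

locale HK_path =
  fixes n Nc :: nat and \<epsilon> \<delta> :: real and V :: "nat \<Rightarrow> nat set" and xs x0 w :: "nat \<Rightarrow> real"
  assumes divisive: "divisive n \<epsilon> Nc V xs x0"
    and delta_pos: "0 < \<delta>" and delta_le: "\<delta> \<le> \<epsilon> / (2 * real n)"
    and noise_le: "\<And>t. t \<ge> 1 \<Longrightarrow> \<bar>w t\<bar> \<le> \<delta>"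
begin

abbreviation y :: "nat \<Rightarrow> nat \<Rightarrow> real" where "y \<equiv> HK n \<epsilon> x0 w"

definition U :: "nat \<Rightarrow> nat set" where "U k = (\<Union>g\<in>{1..k}. V g)"

lemma n_ge: "2 \<le> Nc" "Nc \<le> n" using divisive by (auto simp: divisive_def)

lemma eps_ge: "2 * real n * \<delta> \<le> \<epsilon>"
  using delta_le n_ge by (simp add: field_simps)

lemma delta_le_eps: "4 * \<delta> \<le> \<epsilon>"
proof -
  have "4 * \<delta> \<le> 2 * real n * \<delta>" using n_ge delta_pos by (intro mult_right_mono) auto
  then show ?thesis using eps_ge by linarith
qed

lemma U_all: "U Nc = {1..n}" using divisive by (auto simp: divisive_def U_def)

lemma V_subset: "g \<in> {1..Nc} \<Longrightarrow> V g \<subseteq> {1..n}"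
  using U_all by (auto simp: U_def)

lemma U_subset: "k \<le> Nc \<Longrightarrow> U k \<subseteq> {1..n}"
  using V_subset by (fastforce simp: U_def)

lemma finite_U: "k \<le> Nc \<Longrightarrow> finite (U k)" using U_subset finite_subset by blast

lemma finite_V: "g \<in> {1..Nc} \<Longrightarrow> finite (V g)" using V_subset finite_subset by blast

lemma V_nonempty: "g \<in> {1..Nc} \<Longrightarrow> V g \<noteq> {}"
  using divisive by (auto simp: divisive_def)

lemma one_in_U: "1 \<le> k \<Longrightarrow> 1 \<in> U k" using divisive by (auto simp: divisive_def U_def)

lemma V_disjoint: "g \<in> {1..Nc} \<Longrightarrow> h \<in> {1..Nc} \<Longrightarrow> g \<noteq> h \<Longrightarrow> V g \<inter> V h = {}"
  using divisive by (auto simp: divisive_def disjoint_family_on_def)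

lemma U_V_disjoint: "k < g \<Longrightarrow> g \<le> Nc \<Longrightarrow> U k \<inter> V g = {}"
  using V_disjoint[of g] unfolding U_def by (auto simp: disjoint_iff)

lemma U_Suc: "U (Suc k) = U k \<union> V (Suc k)"
  by (auto simp: U_def atLeastAtMostSuc_conv)

lemma agent_cases:
  assumes "j \<in> {1..n}"
  obtains "j \<in> U k" | g where "k < g" "g \<le> Nc" "j \<in> V g"
proof -
  obtain g where g: "g \<in> {1..Nc}" "j \<in> V g" using assms unfolding U_all[symmetric] U_def by blast
  show ?thesis
  proof (cases "g \<le> k")
    case True
    then have "j \<in> U k" using g unfolding U_def by fastforce
    then show ?thesis by (rule that(1))
  next
    case False
    then show ?thesis using g by (intro that(2)) auto
  qed
qed

lemma xs_gap: "q < p \<Longrightarrow> 1 \<le> q \<Longrightarrow> p \<le> Nc \<Longrightarrow> xs q + \<epsilon> < xs p"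
  using divisive unfolding divisive_def
  by (metis add.commute atLeastAtMost_iff less_diff_eq less_imp_le order_trans)

lemma eps_pos: "0 < \<epsilon>" using delta_le_eps delta_pos by linarith

lemma xs_apart:
  assumes "g \<in> {1..Nc}" "h \<in> {1..Nc}" "g \<noteq> h"
  shows "\<bar>xs g - xs h\<bar> > \<epsilon>"
  using xs_gap[of g h] xs_gap[of h g] assms by (cases "g < h") auto

text \<open>Clusters \<open>1, \<dots>, k\<close> have merged at \<open>a\<close>, where \<open>r\<close> is the noise that agent 1 received last;
  the other clusters have not moved, and only agent 1 may see one of them.\<close>

definition clustered :: "nat \<Rightarrow> nat \<Rightarrow> real \<Rightarrow> real \<Rightarrow> bool" where
  "clustered k t a r \<longleftrightarrow> 1 \<le> k \<and> k \<le> Nc \<and> \<bar>r\<bar> \<le> \<delta> \<and>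
     (\<forall>i\<in>U k. y t i = a + (if i = 1 then r else 0)) \<and>
     (\<forall>g\<in>{k<..Nc}. (\<forall>i\<in>V g. y t i = xs g) \<and> a + \<epsilon> < xs g)"

section \<open>One-step dynamics: drifting and merging of clusters\<close>

lemma far_cluster_step:
  assumes g: "g \<in> {1..Nc}" and i: "i \<in> V g" and "i \<noteq> 1"
    and own: "\<And>j. j \<in> V g \<Longrightarrow> y t j = xs g"
    and other: "\<And>j. j \<in> {1..n} - V g \<Longrightarrow> \<bar>y t j - xs g\<bar> > \<epsilon>"
  shows "y (Suc t) i = xs g"
proof -
  have "neighbors n \<epsilon> (y t) i = V g"
    unfolding neighbors_def using own[OF i] own other V_subset[OF g] eps_pos
    by (auto simp: set_eq_iff; smt (verit) Diff_iff atLeastAtMost_iff)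
  from HK_Suc_neighbors[OF this] show ?thesis
    using own \<open>i \<noteq> 1\<close> V_nonempty[OF g] finite_V[OF g] by simp
qed

text \<open>Agents of \<open>U k\<close> that all see each other and nobody else average over the
  same set, so one step brings them to a common mean, with fresh noise on agent 1 only. This drives
  the drift and also completes a merge.\<close>

lemma gather_step:
  assumes k: "1 \<le> k" "k \<le> Nc"
    and far: "\<And>g i. g \<in> {k<..Nc} \<Longrightarrow> i \<in> V g \<Longrightarrow> y t i = xs g"
    and below: "\<And>g i. g \<in> {k<..Nc} \<Longrightarrow> i \<in> U k \<Longrightarrow> y t i + \<epsilon> < xs g"
    and near: "\<And>i j. i \<in> U k \<Longrightarrow> j \<in> U k \<Longrightarrow> \<bar>y t j - y t i\<bar> \<le> \<epsilon>"
  shows "clustered k (Suc t) ((\<Sum>j\<in>U k. y t j) / real (card (U k))) (w (Suc t))"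
proof -
  have card: "0 < card (U k)" using one_in_U[OF k(1)] finite_U[OF k(2)] card_gt_0_iff by blast
  have new: "y (Suc t) i = (\<Sum>j\<in>U k. y t j) / real (card (U k)) + (if i = 1 then w (Suc t) else 0)"
    if i: "i \<in> U k" for i
  proof (rule HK_Suc_neighbors)
    have "\<bar>y t j - y t i\<bar> > \<epsilon>" if "k < g" "g \<le> Nc" "j \<in> V g" for j g
      using far[of g j] below[of g i] that i by auto
    then show "neighbors n \<epsilon> (y t) i = U k"
      unfolding neighbors_def using near[OF i] U_subset[OF k(2)]
      by (auto; metis agent_cases atLeastAtMost_iff linorder_not_less One_nat_def)
  qed
  have far': "y (Suc t) i = xs g" if g: "g \<in> {k<..Nc}" and i: "i \<in> V g" for g i
  proof (rule far_cluster_step)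
    show g1: "g \<in> {1..Nc}" using g by auto
    show "i \<noteq> 1" using U_V_disjoint[of k g] one_in_U[OF k(1)] g i by auto
    show "\<bar>y t j - xs g\<bar> > \<epsilon>" if j: "j \<in> {1..n} - V g" for j
    proof -
      have jn: "j \<in> {1..n}" using j by blast
      show ?thesis
      proof (cases rule: agent_cases[OF jn, of k])
        case 1 then show ?thesis using below[OF g] by fastforce
      next
        case (2 h)
        then show ?thesis using far[of h j] xs_apart[of g h] g1 j k by (cases "g = h") auto
      qed
    qed
  qed (use far g i in auto)
  \<comment> \<open>The mean inherits the strict upper bound shared by all averaged
    opinions.\<close>
  have "(\<Sum>j\<in>U k. y t j) / real (card (U k)) + \<epsilon> < xs g" if g: "g \<in> {k<..Nc}" for g
  proof -
    have "(\<Sum>j\<in>U k. y t j) < (\<Sum>j\<in>U k. xs g - \<epsilon>)"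
      using below[OF g] finite_U[OF k(2)] one_in_U[OF k(1)]
      by (intro sum_strict_mono) (auto simp: less_diff_eq)
    then show ?thesis using card by (simp add: field_simps)
  qed
  then show ?thesis unfolding clustered_def using k new far' noise_le[of "Suc t"] by simp
qed

lemma sum_clustered:
  assumes "clustered k t a r"
  shows "(\<Sum>j\<in>U k. y t j) = real (card (U k)) * a + r"
proof -
  have k: "1 \<le> k" "k \<le> Nc" using assms by (auto simp: clustered_def)
  have "(\<Sum>j\<in>U k. y t j) = (\<Sum>j\<in>U k. a + (if j = 1 then r else 0))"
    using assms by (intro sum.cong) (auto simp: clustered_def)
  then show ?thesis using one_in_U[OF k(1)] finite_U[OF k(2)]
    by (simp add: sum.distrib sum.delta)
qed

text \<open>With agent 1 out of sight of the higher clusters, \<open>U k\<close> evolves as a closed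
  system. Writing \<open>m\<close> for its size, the new centre \<open>a'\<close> satisfies
  \<open>m * a' = m * a + r\<close>, so \<open>m * a + r\<close> increases by exactly the fresh
  noise.\<close>

lemma drift_step:
  assumes c: "clustered k t a r" and far: "\<And>g. g \<in> {k<..Nc} \<Longrightarrow> a + r + \<epsilon> < xs g"
  shows "clustered k (Suc t) ((real (card (U k)) * a + r) / real (card (U k))) (w (Suc t))"
proof -
  have "clustered k (Suc t) ((\<Sum>j\<in>U k. y t j) / real (card (U k))) (w (Suc t))"
  proof (rule gather_step)
    show "y t i + \<epsilon> < xs g" if "g \<in> {k<..Nc}" "i \<in> U k" for g i
      using c far[of g] that by (auto simp: clustered_def)
    show "\<bar>y t j - y t i\<bar> \<le> \<epsilon>" if "i \<in> U k" "j \<in> U k" for i j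
      using c that delta_le_eps delta_pos by (auto simp: clustered_def)
  qed (use c in \<open>auto simp: clustered_def\<close>)
  then show ?thesis by (simp add: sum_clustered[OF c])
qed

text \<open>Agent 1 at \<open>a + r\<close> sees the next cluster, of size \<open>p\<close> at \<open>b\<close>. One step later the lower cluster is
  at \<open>a'\<close>, the upper one at \<open>b'\<close> and agent 1 at \<open>c\<close>. The bound by \<open>b\<close> keeps all of them out of sight
  of the clusters still higher up.\<close>

lemma merge_estimates:
  fixes a b r m p v :: real
  assumes "1 \<le> m" "1 \<le> p" "2 * (m + p) * \<delta> \<le> \<epsilon>"
    and "\<bar>r\<bar> \<le> \<delta>" "\<bar>v\<bar> \<le> \<delta>" and "a + \<epsilon> < b" "b - (a + r) \<le> \<epsilon>"
  defines "a' \<equiv> (m * a + r) / m" and "b' \<equiv> (p * b + (a + r)) / (p + 1)"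
    and "c \<equiv> (m * a + r + p * b) / (m + p) + v"
  shows "\<bar>b' - a'\<bar> \<le> \<epsilon>" "\<bar>c - a'\<bar> \<le> \<epsilon>" "\<bar>c - b'\<bar> \<le> \<epsilon>" "a' \<le> b" "b' \<le> b" "c \<le> b"
proof -
  \<comment> \<open>Agent 1 sees the upper cluster although the position \<open>a\<close> is too far
    from it, so its last noise was positive.\<close>
  have r: "0 < r" "r \<le> \<delta>" using assms by linarith+
  define G where "G = b - (a + r)"
  have G: "\<epsilon> - \<delta> \<le> G" "G \<le> \<epsilon>" using assms r by (auto simp: G_def)
  have d: "0 < \<delta>" by (rule delta_pos)
  have e: "4 * \<delta> \<le> \<epsilon>" by (rule delta_le_eps)
  define D where "D = b - a'"
  have a': "a' = a + r / m" using assms(1) by (simp add: a'_def field_simps)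
  have rm: "0 \<le> r / m" "r / m \<le> r"
    using assms(1) r by (auto simp: divide_le_eq mult_le_cancel_left1)
  have D: "\<epsilon> - \<delta> \<le> D" "D \<le> \<epsilon> + \<delta>"
    using rm r G assms(6,7) unfolding D_def a' G_def by linarith+
  have b': "b' = b - G / (p + 1)" using assms(2) by (simp add: b'_def G_def field_simps)
  have Np: "0 < m + p" using assms by linarith
  \<comment> \<open>Up to the noise \<open>v\<close>, \<open>c\<close> is a weighted mean of
    \<open>a'\<close> and \<open>b\<close>; it is measured once downwards from \<open>b\<close> and
    once upwards from \<open>a'\<close>.\<close>
  have c1: "c = b - m / (m + p) * D + v" and c2: "c = a' + p / (m + p) * D + v"
  proof -
    have "m * a' = m * a + r" using assms(1) by (simp add: a'_def)
    then have e1: "m * a + r + p * b = (m + p) * b - m * D"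
      and e2: "m * a + r + p * b = (m + p) * a' + p * D"
      by (simp_all add: D_def algebra_simps)
    show "c = b - m / (m + p) * D + v"
      unfolding c_def e1 using Np by (simp add: diff_divide_distrib)
    show "c = a' + p / (m + p) * D + v"
      unfolding c_def e2 using Np by (simp add: add_divide_distrib)
  qed
  \<comment> \<open>Here the smallness of the noise enters: a share \<open>1 / (m + p)\<close> of
    \<open>\<epsilon>\<close> covers two noise amplitudes.\<close>
  have dN: "2 * \<delta> \<le> \<epsilon> / (m + p)" using assms(3) Np by (simp add: field_simps)
  have Gp1: "G / (p + 1) \<le> \<epsilon> / 2"
  proof -
    have "G / (p + 1) \<le> G / 2" using G d e assms(2) by (intro divide_left_mono) auto
    then show ?thesis using G by linarith
  qed
  have Gp0: "0 \<le> G / (p + 1)" using G d e assms(2) by simp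
  have Gp2: "G / (p + 1) \<le> G" using G d e assms(2) by (simp add: divide_le_eq mult_le_cancel_left1)
  \<comment> \<open>The upper cluster moves by \<open>G / (p + 1)\<close> towards agent 1. As
    \<open>p + 1 \<le> m + p\<close>, the remaining gap is at least \<open>2 * \<delta>\<close>
    short of \<open>\<epsilon>\<close>, which pays for the term \<open>r - r / m\<close> in
    \<open>b' - a'\<close>.\<close>
  have Gp: "G - G / (p + 1) \<le> \<epsilon> - 2 * \<delta>"
  proof -
    have "G - G / (p + 1) = G * (p / (p + 1))" using assms(2) by (simp add: field_simps)
    also have "\<dots> \<le> \<epsilon> * (p / (p + 1))" using G assms(2) by (intro mult_right_mono) auto
    also have "\<dots> = \<epsilon> - \<epsilon> / (p + 1)" using assms(2) by (simp add: field_simps)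
    also have "\<dots> \<le> \<epsilon> - \<epsilon> / (m + p)"
      using assms(1,2) e d by (intro diff_left_mono divide_left_mono) auto
    finally show ?thesis using dN by linarith
  qed
  \<comment> \<open>Needed for the weights \<open>q = m\<close> and \<open>q = p\<close>. The margin
    \<open>\<delta>\<close> at either end leaves room for the noise \<open>v\<close>.\<close>
  have share: "q / (m + p) * D \<le> \<epsilon> - \<delta>" "\<delta> \<le> q / (m + p) * D" if q: "1 \<le> q" "q \<le> m + p - 1" for q
  proof -
    have "q / (m + p) \<le> (m + p - 1) / (m + p)" using q Np by (intro divide_right_mono) auto
    also have "\<dots> = 1 - 1 / (m + p)" using Np by (simp add: diff_divide_distrib)
    finally have "q / (m + p) * D \<le> (1 - 1 / (m + p)) * (\<epsilon> + \<delta>)"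
      using D d e Np assms(1,2) by (intro mult_mono) auto
    also have "\<dots> = \<epsilon> + \<delta> - (\<epsilon> / (m + p) + \<delta> / (m + p))"
      by (simp add: algebra_simps add_divide_distrib)
    also have "\<dots> \<le> \<epsilon> - \<delta>" using dN Np d by (smt (verit) divide_pos_pos)
    finally show "q / (m + p) * D \<le> \<epsilon> - \<delta>" .
    have "\<delta> \<le> 2 * \<delta> - \<delta> / (m + p)"
      using d assms(1,2) Np by (simp add: divide_le_eq mult_le_cancel_left1)
    also have "\<dots> \<le> 1 / (m + p) * (\<epsilon> - \<delta>)"
      using dN by (simp add: diff_divide_distrib)
    also have "\<dots> \<le> q / (m + p) * D"
      using q Np D d e by (intro mult_mono divide_right_mono) auto
    finally show "\<delta> \<le> q / (m + p) * D" .
  qed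
  have sm: "m / (m + p) * D \<le> \<epsilon> - \<delta>" "\<delta> \<le> m / (m + p) * D"
    using share[of m] assms(1,2) by auto
  have sp: "p / (m + p) * D \<le> \<epsilon> - \<delta>" "\<delta> \<le> p / (m + p) * D"
    using share[of p] assms(1,2) by auto
  have "b' - a' = G - G / (p + 1) + (r - r / m)" unfolding b' a' G_def by simp
  then show "\<bar>b' - a'\<bar> \<le> \<epsilon>" using Gp Gp2 rm r d by linarith
  show "\<bar>c - a'\<bar> \<le> \<epsilon>" unfolding c2 using sp assms(5) d by linarith
  show "\<bar>c - b'\<bar> \<le> \<epsilon>" unfolding c1 b' using sm assms(5) d e Gp0 Gp1 by linarith
  show "a' \<le> b" using D d e unfolding D_def by linarith
  show "b' \<le> b" unfolding b' using Gp0 by linarith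
  show "c \<le> b" unfolding c1 using sm assms(5) by linarith
qed

text \<open>At time \<open>t\<close> agent 1 is the only link between the two clusters, so exactly
  three neighbour sets occur among their agents. By \<open>merge_estimates\<close> the three
  resulting opinions are mutually visible, and the second step is \<open>gather_step\<close> for
  \<open>Suc k\<close>.\<close>

lemma merge_step:
  assumes c: "clustered k t a r" and k: "k < Nc" and reach: "xs (Suc k) - (a + r) \<le> \<epsilon>"
  shows "\<exists>a' r'. clustered (Suc k) (Suc (Suc t)) a' r'"
proof -
  define b where "b = xs (Suc k)"
  define m where "m = card (U k)"
  define p where "p = card (V (Suc k))"
  define v where "v = w (Suc t)"
  have k1: "1 \<le> k" using c by (simp add: clustered_def)
  have Sk: "Suc k \<in> {1..Nc}" using k by auto
  have fU: "finite (U k)" and fV: "finite (V (Suc k))" using finite_U finite_V k Sk by auto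
  have dis: "U k \<inter> V (Suc k) = {}" using U_V_disjoint k by simp
  have m: "1 \<le> m" using one_in_U[OF k1] fU unfolding m_def by (metis One_nat_def Suc_leI card_gt_0_iff emptyE)
  have p: "1 \<le> p" using V_nonempty[OF Sk] fV unfolding p_def by (simp add: Suc_leI card_gt_0_iff)
  have mp: "card (U k \<union> V (Suc k)) = m + p"
    unfolding m_def p_def using fU fV dis by (rule card_Un_disjoint)
  have "m + p \<le> n"
    using mp card_mono[OF _ U_subset[of "Suc k"]] k by (simp add: U_Suc)
  then have "2 * (real m + real p) * \<delta> \<le> 2 * real n * \<delta>"
    using delta_pos by (intro mult_right_mono) auto
  then have mpd: "2 * (real m + real p) * \<delta> \<le> \<epsilon>" using eps_ge by linarith
  have r: "\<bar>r\<bar> \<le> \<delta>" and ab: "a + \<epsilon> < b" using c k by (auto simp: clustered_def b_def)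
  have v: "\<bar>v\<bar> \<le> \<delta>" unfolding v_def by (rule noise_le) simp
  have reach': "b - (a + r) \<le> \<epsilon>" using reach by (simp add: b_def)
  note est = merge_estimates[of "real m" "real p", OF _ _ mpd r v ab reach']
  have est:
    "\<bar>(p * b + (a + r)) / (p + 1) - (m * a + r) / m\<bar> \<le> \<epsilon>"
    "\<bar>(m * a + r + p * b) / (m + p) + v - (m * a + r) / m\<bar> \<le> \<epsilon>"
    "\<bar>(m * a + r + p * b) / (m + p) + v - (p * b + (a + r)) / (p + 1)\<bar> \<le> \<epsilon>"
    "(m * a + r) / m \<le> b" "(p * b + (a + r)) / (p + 1) \<le> b" "(m * a + r + p * b) / (m + p) + v \<le> b"
    using est m p by (simp_all add: add.commute)
  have yU: "y t i = a" if "i \<in> U k" "i \<noteq> 1" for i using c that by (auto simp: clustered_def)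
  have y1: "y t 1 = a + r" using c one_in_U[OF k1] by (auto simp: clustered_def)
  have yb: "y t i = b" if "i \<in> V (Suc k)" for i using c that k by (auto simp: clustered_def b_def)
  have yV: "y t i = xs g" if "i \<in> V g" "g \<in> {Suc k<..Nc}" for i g
    using c that by (auto simp: clustered_def)
  have bg: "b + \<epsilon> < xs g" if "g \<in> {Suc k<..Nc}" for g
    using xs_gap[of "Suc k" g] that k1 by (auto simp: b_def)
  have r': "r \<le> \<epsilon>" "-\<epsilon> \<le> r" "0 < \<epsilon>" "0 < r" using r delta_le_eps delta_pos ab reach' by auto
  have oneU: "1 \<in> U k" by (rule one_in_U[OF k1])
  have oneV: "1 \<notin> V (Suc k)" using oneU dis by auto
  have sub: "U k \<subseteq> {1..n}" "V (Suc k) \<subseteq> {1..n}" using U_subset k V_subset[OF Sk] by auto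
  have cases: "j \<in> U k \<or> j \<in> V (Suc k) \<or> (\<exists>g\<in>{Suc k<..Nc}. j \<in> V g)" if "j \<in> {1..n}" for j
    using that by (cases rule: agent_cases[of j "Suc k"]) (auto simp: U_Suc)
  have N1: "neighbors n \<epsilon> (y t) 1 = U k \<union> V (Suc k)"
  proof (rule set_eqI)
    fix j
    show "j \<in> neighbors n \<epsilon> (y t) 1 \<longleftrightarrow> j \<in> U k \<union> V (Suc k)"
    proof
      assume j: "j \<in> neighbors n \<epsilon> (y t) 1"
      then have "j \<in> {1..n}" "\<bar>y t j - (a + r)\<bar> \<le> \<epsilon>"
        unfolding neighbors_def y1 by blast+
      then show "j \<in> U k \<union> V (Suc k)" using cases[of j] yV bg ab r' by fastforce
    next
      assume j: "j \<in> U k \<union> V (Suc k)"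
      then have "y t j = a \<or> y t j = a + r \<or> y t j = b" using yU yb y1 by auto
      then have "\<bar>y t j - (a + r)\<bar> \<le> \<epsilon>" using reach' r' ab by auto
      then show "j \<in> neighbors n \<epsilon> (y t) 1" using j sub
        unfolding neighbors_def y1 by blast
    qed
  qed
  have NU: "neighbors n \<epsilon> (y t) i = U k" if i: "i \<in> U k" "i \<noteq> 1" for i
  proof (rule set_eqI)
    fix j
    show "j \<in> neighbors n \<epsilon> (y t) i \<longleftrightarrow> j \<in> U k"
    proof
      assume j: "j \<in> neighbors n \<epsilon> (y t) i"
      then have "j \<in> {1..n}" "\<bar>y t j - a\<bar> \<le> \<epsilon>" by (auto simp: neighbors_def yU[OF i])
      then show "j \<in> U k" using cases[of j] yV yb bg ab r' by fastforce
    next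
      assume j: "j \<in> U k"
      then have "y t j = a \<or> y t j = a + r" using yU y1 by auto
      then have "\<bar>y t j - a\<bar> \<le> \<epsilon>" using r' by auto
      then show "j \<in> neighbors n \<epsilon> (y t) i" using j sub yU[OF i] by (auto simp: neighbors_def)
    qed
  qed
  have NV: "neighbors n \<epsilon> (y t) i = insert 1 (V (Suc k))" if i: "i \<in> V (Suc k)" for i
  proof (rule set_eqI)
    fix j
    show "j \<in> neighbors n \<epsilon> (y t) i \<longleftrightarrow> j \<in> insert 1 (V (Suc k))"
    proof
      assume j: "j \<in> neighbors n \<epsilon> (y t) i"
      then have "j \<in> {1..n}" "\<bar>y t j - b\<bar> \<le> \<epsilon>" by (auto simp: neighbors_def yb[OF i])
      then show "j \<in> insert 1 (V (Suc k))" using cases[of j] yV yU bg ab r' by fastforce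
    next
      assume j: "j \<in> insert 1 (V (Suc k))"
      then have "y t j = b \<or> y t j = a + r" using yb y1 by auto
      then have "\<bar>y t j - b\<bar> \<le> \<epsilon>" using r' ab reach' by auto
      then show "j \<in> neighbors n \<epsilon> (y t) i" using j sub oneU yb[OF i] by (auto simp: neighbors_def)
    qed
  qed
  have sU: "(\<Sum>j\<in>U k. y t j) = m * a + r" using sum_clustered[OF c] by (simp add: m_def)
  have sV: "(\<Sum>j\<in>V (Suc k). y t j) = p * b" by (simp add: yb p_def)
  have new1: "y (Suc t) 1 = (m * a + r + p * b) / (m + p) + v"
    using HK_Suc_neighbors[OF N1] mp by (simp add: sum.union_disjoint[OF fU fV dis] sU sV v_def del: HK.simps)
  have newU: "y (Suc t) i = (m * a + r) / m" if "i \<in> U k" "i \<noteq> 1" for i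
    using HK_Suc_neighbors[OF NU[OF that]] that by (simp add: sU m_def del: HK.simps)
  have newV: "y (Suc t) i = (p * b + (a + r)) / (p + 1)" if i: "i \<in> V (Suc k)" for i
  proof -
    have "(\<Sum>j\<in>insert 1 (V (Suc k)). y t j) = p * b + (a + r)"
      using oneV fV sV y1 by simp
    moreover have "card (insert 1 (V (Suc k))) = p + 1" using oneV fV by (simp add: p_def)
    ultimately show ?thesis using HK_Suc_neighbors[OF NV[OF i]] i oneV
      by (auto simp del: HK.simps)
  qed
  have newF: "y (Suc t) i = xs g" if g: "g \<in> {Suc k<..Nc}" and i: "i \<in> V g" for g i
  proof (rule far_cluster_step)
    show g1: "g \<in> {1..Nc}" using g by auto
    show "i \<noteq> 1" using U_V_disjoint[of k g] oneU g i by auto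
    show "y t j = xs g" if "j \<in> V g" for j using yV that g by blast
    show "\<bar>y t j - xs g\<bar> > \<epsilon>" if j: "j \<in> {1..n} - V g" for j
    proof -
      consider "j \<in> U k \<union> V (Suc k)" | h where "h \<in> {Suc k<..Nc}" "j \<in> V h"
        using cases[of j] j by blast
      then show ?thesis
      proof cases
        case 1
        then have "y t j = a \<or> y t j = a + r \<or> y t j = b" using yU yb y1 by auto
        then show ?thesis using bg[OF g] ab r' by auto
      next
        case (2 h)
        then show ?thesis using yV[of j h] xs_apart[of h g] g1 j by (cases "h = g") auto
      qed
    qed
  qed (use i in auto)
  have new: "y (Suc t) i \<in> {(m * a + r + p * b) / (m + p) + v, (m * a + r) / m, (p * b + (a + r)) / (p + 1)}"
    if "i \<in> U (Suc k)" for i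
    using that new1 newU newV by (cases "i = 1") (auto simp: U_Suc simp del: HK.simps)
  have "clustered (Suc k) (Suc (Suc t))
    ((\<Sum>j\<in>U (Suc k). y (Suc t) j) / real (card (U (Suc k)))) (w (Suc (Suc t)))"
  proof (rule gather_step)
    show "y (Suc t) i + \<epsilon> < xs g" if "g \<in> {Suc k<..Nc}" "i \<in> U (Suc k)" for g i
    proof -
      \<comment> \<open>No opinion passes \<open>b\<close>, and \<open>b\<close> itself is more than
        \<open>\<epsilon>\<close> below every higher cluster.\<close>
      have "y (Suc t) i \<le> b" using new[OF that(2)] est by (auto simp del: HK.simps)
      then show ?thesis using bg[OF that(1)] by linarith
    qed
    show "\<bar>y (Suc t) j - y (Suc t) i\<bar> \<le> \<epsilon>" if "i \<in> U (Suc k)" "j \<in> U (Suc k)" for i j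
      using new[OF that(1)] new[OF that(2)] est(1-3) r'(3)
      by (elim insertE emptyE; simp only:; linarith)
  qed (use k newF in auto)
  then show ?thesis by blast
qed

section \<open>Absorbing the clusters one after the other\<close>

lemma clustered_0: "clustered 1 0 (xs 1) 0"
  using divisive n_ge delta_pos xs_gap[of 1]
  by (auto simp: clustered_def divisive_def U_def)

text \<open>The premise \<open>no\<close> lets \<open>drift_step\<close> be iterated without end;
  its increments add up to the noise sum.\<close>

lemma drift_until_reach:
  assumes c: "clustered k t a r"
    and no: "\<And>s a' r'. clustered k (t + s) a' r' \<Longrightarrow> \<forall>g\<in>{k<..Nc}. a' + r' + \<epsilon> < xs g"
  shows "\<exists>a' r'. clustered k (t + s) a' r' \<and>
    real (card (U k)) * a' + r' = real (card (U k)) * a + r + (\<Sum>u<s. w (Suc (t + u)))"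
proof (induction s)
  case 0
  then show ?case using c by auto
next
  case (Suc s)
  then obtain a' r' where s: "clustered k (t + s) a' r'"
    "real (card (U k)) * a' + r' = real (card (U k)) * a + r + (\<Sum>u<s. w (Suc (t + u)))" by blast
  have "0 < card (U k)"
    using c one_in_U finite_U card_gt_0_iff by (metis clustered_def empty_iff)
  then show ?case
    using drift_step[OF s(1)] no[OF s(1)] s(2) by (auto intro!: exI)
qed

text \<open>Without a merge, \<open>m * a + r\<close> would follow the noise sums forever, whereas
  \<open>clustered\<close> keeps \<open>a\<close> below \<open>xs (Suc k)\<close> and
  \<open>r\<close> at most \<open>\<delta>\<close>.\<close>

lemma next_phase:
  assumes c: "clustered k t a r" and k: "k < Nc"
    and unb: "\<And>K. \<exists>s. (\<Sum>u<s. w (Suc u)) > K"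
  shows "\<exists>t a r. clustered (Suc k) t a r"
proof (rule ccontr)
  assume none: "\<not> ?thesis"
  have k1: "1 \<le> k" using c by (simp add: clustered_def)
  have no: "\<forall>g\<in>{k<..Nc}. a' + r' + \<epsilon> < xs g" if c': "clustered k (t + s) a' r'" for s a' r'
  proof
    fix g assume g: "g \<in> {k<..Nc}"
    have "xs (Suc k) - (a' + r') > \<epsilon>" using merge_step[OF c' k] none by fastforce
    moreover have "xs (Suc k) \<le> xs g"
      using xs_gap[of "Suc k" g] g k1 eps_pos by (cases "g = Suc k") auto
    ultimately show "a' + r' + \<epsilon> < xs g" by linarith
  qed
  define m where "m = real (card (U k))"
  \<comment> \<open>Noise sums above \<open>K\<close> push \<open>m * a' + r'\<close> beyond
    \<open>m * xs (Suc k) + \<delta>\<close>. The noise before time \<open>t\<close> is included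
    because \<open>unb\<close> sums from the start.\<close>
  define K where "K = m * xs (Suc k) + \<delta> - m * a - r + (\<Sum>u<t. w (Suc u)) + (\<Sum>u<t. \<delta>)"
  \<comment> \<open>Each noise is at most \<open>\<delta>\<close>, so a sum above
    \<open>t * \<delta>\<close> needs more than \<open>t\<close> terms; this places \<open>s\<close>
    after \<open>t\<close>.\<close>
  obtain s where s: "(\<Sum>u<s. w (Suc u)) > max K (\<Sum>u<t. \<delta>)" using unb by blast
  have "(\<Sum>u<s. w (Suc u)) \<le> (\<Sum>u<s. \<delta>)" using noise_le by (intro sum_mono) (smt (verit) le_add1 plus_1_eq_Suc)
  then have "real s * \<delta> > real t * \<delta>" using s by simp
  then have "t \<le> s" using delta_pos by simp
  then obtain q where q: "s = t + q" using le_Suc_ex by blast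
  have split: "(\<Sum>u<s. w (Suc u)) = (\<Sum>u<t. w (Suc u)) + (\<Sum>u<q. w (Suc (t + u)))"
    unfolding q by (induction q) auto
  have "\<exists>a' r'. clustered k (t + q) a' r' \<and>
    m * a' + r' = m * a + r + (\<Sum>u<q. w (Suc (t + u)))"
    unfolding m_def by (rule drift_until_reach[OF c no])
  then obtain a' r' where ar: "clustered k (t + q) a' r'"
    "m * a' + r' = m * a + r + (\<Sum>u<q. w (Suc (t + u)))" by blast
  have "Suc k \<in> {k<..Nc}" using k by auto
  then have "a' + \<epsilon> < xs (Suc k)" "\<bar>r'\<bar> \<le> \<delta>" using ar(1) unfolding clustered_def by blast+
  then have "a' \<le> xs (Suc k)" "r' \<le> \<delta>" using eps_pos by auto
  moreover have "m * a' \<le> m * xs (Suc k)" using calculation by (intro mult_left_mono) (auto simp: m_def)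
  moreover have "0 \<le> (\<Sum>u<t. \<delta>)" using delta_pos by simp
  ultimately show False using s split ar(2) unfolding K_def by linarith
qed

lemma consensus_reached:
  assumes unb: "\<And>K. \<exists>s. (\<Sum>u<s. w (Suc u)) > K"
  shows "consensus_time n \<delta> y < \<infinity>"
proof -
  have "\<exists>t a r. clustered (Suc k) t a r" if "Suc k \<le> Nc" for k
    using that
  proof (induction k)
    case 0
    then show ?case using clustered_0 by auto
  next
    case (Suc k)
    then show ?case using next_phase[OF _ _ unb] by (meson Suc_le_eq Suc_leD)
  qed
  from this[of "Nc - 1"] obtain t a r where c: "clustered Nc t a r" using n_ge by auto
  \<comment> \<open>For \<open>k = Nc\<close> no higher cluster remains: the premise of
    \<open>drift_until_reach\<close> is vacuous and the merged state persists, with only the noise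
    \<open>r\<close> separating agent 1 from the rest.\<close>
  have "\<exists>a' r'. clustered Nc (t + s) a' r' \<and>
      real (card (U Nc)) * a' + r' = real (card (U Nc)) * a + r + (\<Sum>u<s. w (Suc (t + u)))" for s
    by (rule drift_until_reach[OF c]) simp
  then have stay: "\<exists>a r. clustered Nc (t + s) a r" for s by blast
  have "diam n (y t') \<le> \<delta>" if t': "t \<le> t'" for t'
  proof -
    obtain a r where "clustered Nc t' a r" using stay[of "t' - t"] t' by auto
    then show ?thesis using delta_pos n_ge
      by (subst diam_le_iff) (auto simp: clustered_def U_all)
  qed
  then show ?thesis unfolding consensus_time_finite_iff by blast
qed

end

section \<open>Almost sure unboundedness of the noise sums\<close>

text \<open>Makes the bound from the central limit theorem positive. If a right tail were null for
  the normal law, positivity of the density would make it Lebesgue null, yet it contains an interval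
  of length 1.\<close>

lemma cdf_std_normal_less_1: "cdf std_normal_distribution x < 1"
proof -
  interpret N: real_distribution std_normal_distribution
    by (rule real_dist_normal_dist)
  have pos: "N.prob {x<..} \<noteq> 0"
  proof
    assume "N.prob {x<..} = 0"
    then have "AE z in std_normal_distribution. z \<notin> {x<..}"
      by (subst (asm) N.prob_eq_0) auto
    then have "AE z in lborel. 0 < std_normal_density z \<longrightarrow> z \<notin> {x<..}"
      by (subst (asm) AE_density) auto
    then have "AE z in lborel. z \<notin> {x<..}"
      by (rule AE_mp) (auto simp: normal_density_pos)
    then have "emeasure lborel {z \<in> space lborel. \<not> z \<notin> {x<..}} = 0"
      by (subst (asm) AE_iff_measurable[OF _ refl]) auto
    moreover have "emeasure lborel {x<..<x+1} \<le> emeasure lborel {z \<in> space lborel. \<not> z \<notin> {x<..}}"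
      by (intro emeasure_mono) auto
    ultimately show False by simp
  qed
  have "N.prob (space std_normal_distribution - {..x}) = 1 - N.prob {..x}"
    by (rule N.prob_compl) simp
  moreover have "space std_normal_distribution - {..x} = {x<..}" by auto
  ultimately show ?thesis using pos by (simp add: cdf_def zero_less_measure_iff[symmetric])
qed

text \<open>Weak convergence gives convergence of the cdf at continuity points; the normal law has
  no atoms.\<close>

lemma isCont_cdf_std_normal: "isCont (cdf std_normal_distribution) x"
proof -
  interpret N: real_distribution std_normal_distribution
    by (rule real_dist_normal_dist)
  have "emeasure std_normal_distribution {x} = 0"
    by (subst emeasure_density) (auto simp: nn_integral_indicator_singleton)
  then show ?thesis by (simp add: N.isCont_cdf measure_def)
qed

context prob_space
begin

text \<open>Serves to renumber the noise, which starts at time 1, by indices starting at 0.\<close>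

lemma indep_vars_reindex_inj:
  assumes h: "inj_on h I" and X: "indep_vars N X (h ` I)"
  shows "indep_vars (\<lambda>i. N (h i)) (\<lambda>i. X (h i)) I"
  unfolding indep_vars_def2 indep_sets_def
proof (intro conjI ballI allI impI)
  note X' = X[unfolded indep_vars_def2 indep_sets_def]
  show "random_variable (N (h i)) (X (h i))" if "i \<in> I" for i
    using X' that by blast
  show "{X (h i) -` A \<inter> space M |A. A \<in> sets (N (h i))} \<subseteq> events" if "i \<in> I" for i
    using X' that by blast
  fix J A
  assume J: "J \<subseteq> I" "J \<noteq> {}" "finite J"
    and A: "A \<in> (\<Pi> i\<in>J. {X (h i) -` A \<inter> space M |A. A \<in> sets (N (h i))})"
  have hJ: "inj_on h J" using h J(1) by (rule inj_on_subset)
  \<comment> \<open>Relabels the events by the image of \<open>J\<close> under \<open>h\<close>,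
    where independence of \<open>X\<close> is available.\<close>
  define B where "B k = A (the_inv_into J h k)" for k
  have B: "B (h j) = A j" if "j \<in> J" for j
    using that by (simp add: B_def the_inv_into_f_f[OF hJ])
  have "prob (\<Inter>k\<in>h ` J. B k) = (\<Prod>k\<in>h ` J. prob (B k))"
  proof (rule X'[THEN conjunct2, THEN conjunct2, rule_format])
    show "B \<in> (\<Pi> k\<in>h ` J. {X k -` A \<inter> space M |A. A \<in> sets (N k)})"
    proof (rule Pi_I)
      fix k assume "k \<in> h ` J"
      then obtain j where "j \<in> J" "k = h j" by blast
      then show "B k \<in> {X k -` A \<inter> space M |A. A \<in> sets (N k)}"
        using B A by (simp add: Pi_iff)
    qed
  qed (use J in auto)
  then show "prob (\<Inter>j\<in>J. A j) = (\<Prod>j\<in>J. prob (A j))"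
    using B by (simp add: prod.reindex[OF hJ])
qed

text \<open>The standardised sum exceeds 1 with a limiting probability free of \<open>K\<close>;
  since its normalisation is unbounded in \<open>n\<close>, the raw sum then eventually exceeds
  \<open>K\<close> as well.\<close>

lemma prob_partial_sums_exceed:
  fixes X :: "nat \<Rightarrow> 'a \<Rightarrow> real" and \<mu> :: "real measure" and \<sigma> m :: real
  assumes indep: "indep_vars (\<lambda>_. borel) X UNIV"
    and mean: "\<And>n. expectation (X n) = m" and m: "0 \<le> m"
    and \<sigma>: "0 < \<sigma>" "\<And>n. variance (X n) = \<sigma>\<^sup>2"
    and sq: "\<And>n. integrable M (\<lambda>x. (X n x)\<^sup>2)"
    and distr: "\<And>n. distr M borel (X n) = \<mu>"
  shows "1 - cdf std_normal_distribution 1 \<le> prob {x \<in> space M. \<exists>n. K < (\<Sum>i<n. X i x)}"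
proof (rule LIMSEQ_le_const2)
  define S where "S n x = (\<Sum>i<n. X i x - m) / sqrt (real n * \<sigma>\<^sup>2)" for n x
  have [measurable]: "random_variable borel (X n)" for n
    using indep unfolding indep_vars_def2 by simp
  have [measurable]: "random_variable borel (S n)" for n unfolding S_def by measurable
  have "weak_conv_m (\<lambda>n. distr M borel (S n)) std_normal_distribution"
    unfolding S_def by (rule central_limit_theorem[OF indep mean \<sigma>(1) sq \<sigma>(2) distr])
  then have "(\<lambda>n. cdf (distr M borel (S n)) 1) \<longlonglongrightarrow> cdf std_normal_distribution 1"
    using isCont_cdf_std_normal by (auto simp: weak_conv_m_def weak_conv_def)
  then show "(\<lambda>n. 1 - cdf (distr M borel (S n)) 1) \<longlonglongrightarrow> 1 - cdf std_normal_distribution 1"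
    by (intro tendsto_intros)
  \<comment> \<open>From this \<open>N\<close> on, the standard deviation of the sum is above
    \<open>K\<close>.\<close>
  obtain N :: nat where N: "N > (K / \<sigma>)\<^sup>2" using reals_Archimedean2 by blast
  show "\<exists>N. \<forall>n\<ge>N. 1 - cdf (distr M borel (S n)) 1 \<le> prob {x \<in> space M. \<exists>n. K < (\<Sum>i<n. X i x)}"
  proof (intro exI allI impI)
    fix n assume n: "N \<le> n"
    have n0: "(K / \<sigma>)\<^sup>2 < n" using N n by linarith
    have "0 < real n" using n0 by (smt (verit) zero_le_power2)
    have "K / \<sigma> < sqrt n" using n0 real_less_rsqrt by blast
    then have K: "K < sqrt (real n * \<sigma>\<^sup>2)" using \<sigma> by (simp add: real_sqrt_mult field_simps)
    have "cdf (distr M borel (S n)) 1 = prob {x \<in> space M. S n x \<le> 1}"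
      by (simp add: cdf_def measure_distr vimage_def Int_def conj_commute)
    then have "1 - cdf (distr M borel (S n)) 1 = prob (space M - {x \<in> space M. S n x \<le> 1})"
      by (subst prob_compl) auto
    also have "\<dots> \<le> prob {x \<in> space M. \<exists>n. K < (\<Sum>i<n. X i x)}"
    proof (rule finite_measure_mono)
      show "space M - {x \<in> space M. S n x \<le> 1} \<subseteq> {x \<in> space M. \<exists>n. K < (\<Sum>i<n. X i x)}"
      proof
        fix x assume x: "x \<in> space M - {x \<in> space M. S n x \<le> 1}"
        then have "1 < (\<Sum>i<n. X i x - m) / sqrt (real n * \<sigma>\<^sup>2)" by (auto simp: S_def)
        then have "sqrt (real n * \<sigma>\<^sup>2) < (\<Sum>i<n. X i x - m)"
          using \<sigma> \<open>0 < real n\<close> by (simp add: less_divide_eq)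
        \<comment> \<open>The nonnegative mean enters here: removing the centring can only increase
          the sum.\<close>
        also have "\<dots> \<le> (\<Sum>i<n. X i x)" using m by (intro sum_mono) auto
        finally show "x \<in> {x \<in> space M. \<exists>n. K < (\<Sum>i<n. X i x)}" using K x by (auto intro: less_trans)
      qed
    qed measurable
    finally show "1 - cdf (distr M borel (S n)) 1 \<le> prob {x \<in> space M. \<exists>n. K < (\<Sum>i<n. X i x)}" .
  qed
qed

text \<open>Dropping the first \<open>k\<close> summands shifts all longer partial sums by one fixed
  amount, so unboundedness depends only on the \<open>X i\<close> with \<open>i \<ge> k\<close>.
  Natural thresholds keep the quantifiers countable.\<close>

lemma unbounded_partial_sums_tail_event:
  fixes X :: "nat \<Rightarrow> 'a \<Rightarrow> real"
  assumes X: "\<And>i. random_variable borel (X i)"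
  shows "{x \<in> space M. \<forall>K::nat. \<exists>n. K < (\<Sum>i<n. X i x)} \<in>
    tail_events (\<lambda>i. sigma_sets (space M) {X i -` A \<inter> space M | A. A \<in> sets borel})"
  unfolding tail_events_def
proof
  fix k :: nat
  define F where "F = (\<Union>i\<in>{k..}. sigma_sets (space M) {X i -` A \<inter> space M | A. A \<in> sets borel})"
  have F: "F \<subseteq> Pow (space M)" unfolding F_def by (auto dest!: sigma_sets_into_sp[rotated])
  have Xm: "X i \<in> borel_measurable (sigma (space M) F)" if "k \<le> i" for i
  proof (rule measurableI)
    fix A :: "real set" assume "A \<in> sets borel"
    then have "X i -` A \<inter> space M \<in> F" unfolding F_def using that by blast
    then show "X i -` A \<inter> space (sigma (space M) F) \<in> sets (sigma (space M) F)"
      using F by (simp add: space_measure_of_conv)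
  qed simp
  have [measurable]: "(\<lambda>x. \<Sum>j<n. X (k + j) x) \<in> borel_measurable (sigma (space M) F)" for n
    by (intro borel_measurable_sum Xm) simp
  have split: "(\<Sum>i<k + n. X i x) = (\<Sum>i<k. X i x) + (\<Sum>j<n. X (k + j) x)" for n x
    by (induction n) auto
  have "(\<forall>K::nat. \<exists>n. K < (\<Sum>i<n. X i x)) \<longleftrightarrow> (\<forall>K::nat. \<exists>n. K < (\<Sum>j<n. X (k + j) x))" for x
  proof
    assume *: "\<forall>K::nat. \<exists>n. K < (\<Sum>i<n. X i x)"
    show "\<forall>K::nat. \<exists>n. K < (\<Sum>j<n. X (k + j) x)"
    proof
      fix K :: nat
      \<comment> \<open>\<open>B\<close> bounds every sum of at most \<open>k\<close> initial terms.
        A partial sum above \<open>K + 2 * B\<close> therefore has more than \<open>k\<close> terms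
        and stays above \<open>K\<close> without the first \<open>k\<close>.\<close>
      define B where "B = (\<Sum>i<k. \<bar>X i x\<bar>)"
      obtain K' :: nat where K': "K' > K + (B + B)" using reals_Archimedean2 by blast
      obtain n where n: "K' < (\<Sum>i<n. X i x)" using * by blast
      have le: "(\<Sum>i<l. X i x) \<le> B" if "l \<le> k" for l
      proof -
        have "(\<Sum>i<l. X i x) \<le> (\<Sum>i<l. \<bar>X i x\<bar>)" by (intro sum_mono) auto
        also have "\<dots> \<le> B" unfolding B_def using that by (intro sum_mono2) auto
        finally show ?thesis .
      qed
      have "0 \<le> B" by (simp add: B_def sum_nonneg)
      then have "\<not> n \<le> k" using le[of n] n K' by auto
      then obtain q where "n = k + q" using le_Suc_ex nat_le_linear by blast
      then show "\<exists>n. K < (\<Sum>j<n. X (k + j) x)"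
        using n K' split[of x q] le[of k] \<open>0 \<le> B\<close> by (intro exI[of _ q]) auto
    qed
  next
    assume *: "\<forall>K::nat. \<exists>n. K < (\<Sum>j<n. X (k + j) x)"
    show "\<forall>K::nat. \<exists>n. K < (\<Sum>i<n. X i x)"
    proof
      fix K :: nat
      obtain K' :: nat where K': "K' > K - (\<Sum>i<k. X i x)" using reals_Archimedean2 by blast
      obtain n where n: "K' < (\<Sum>j<n. X (k + j) x)" using * by blast
      then show "\<exists>n. K < (\<Sum>i<n. X i x)" using K' split[of x n] by (intro exI[of _ "k + n"]) auto
    qed
  qed
  then have eq: "{x \<in> space M. \<forall>K::nat. \<exists>n. K < (\<Sum>i<n. X i x)} =
      {x \<in> space (sigma (space M) F). \<forall>K::nat. \<exists>n. K < (\<Sum>j<n. X (k + j) x)}"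
    by (simp add: space_measure_of_conv)
  have "\<dots> \<in> sets (sigma (space M) F)" by measurable
  then show "{x \<in> space M. \<forall>K::nat. \<exists>n. K < (\<Sum>i<n. X i x)} \<in> sigma_sets (space M) F"
    unfolding eq using F by simp
qed

text \<open>By continuity from above the bound uniform in the threshold survives the intersection
  over all thresholds; the 0-1 law then lifts a positive probability to 1.\<close>

lemma AE_partial_sums_unbounded:
  fixes X :: "nat \<Rightarrow> 'a \<Rightarrow> real" and \<mu> :: "real measure" and \<sigma> m :: real
  assumes indep: "indep_vars (\<lambda>_. borel) X UNIV"
    and mean: "\<And>n. expectation (X n) = m" and m: "0 \<le> m"
    and \<sigma>: "0 < \<sigma>" "\<And>n. variance (X n) = \<sigma>\<^sup>2"
    and sq: "\<And>n. integrable M (\<lambda>x. (X n x)\<^sup>2)"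
    and distr: "\<And>n. distr M borel (X n) = \<mu>"
  shows "AE x in M. \<forall>K. \<exists>n. K < (\<Sum>i<n. X i x)"
proof -
  have rv[measurable]: "random_variable borel (X n)" for n
    using indep unfolding indep_vars_def2 by simp
  define B where "B k = {x \<in> space M. \<exists>n. real k < (\<Sum>i<n. X i x)}" for k
  have "(\<lambda>k. prob (B k)) \<longlonglongrightarrow> prob (\<Inter>k. B k)"
  proof (rule finite_Lim_measure_decseq)
    show "range B \<subseteq> events" unfolding B_def by auto
    show "decseq B" unfolding B_def decseq_def by (auto intro: le_less_trans of_nat_mono)
  qed
  then have "1 - cdf std_normal_distribution 1 \<le> prob (\<Inter>k. B k)"
    unfolding B_def
    by (rule LIMSEQ_le_const) (use prob_partial_sums_exceed[OF assms] in blast)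
  then have "prob (\<Inter>k. B k) \<noteq> 0" using cdf_std_normal_less_1[of 1] by linarith
  moreover have eq: "(\<Inter>k. B k) = {x \<in> space M. \<forall>K::nat. \<exists>n. K < (\<Sum>i<n. X i x)}"
    unfolding B_def by auto
  moreover have "prob (\<Inter>k. B k) = 0 \<or> prob (\<Inter>k. B k) = 1"
  proof (rule kolmogorov_0_1_law)
    show "(\<Inter>k. B k) \<in> tail_events (\<lambda>i. sigma_sets (space M) {X i -` A \<inter> space M | A. A \<in> sets borel})"
      unfolding eq by (rule unbounded_partial_sums_tail_event[OF rv])
    show "indep_sets (\<lambda>i. sigma_sets (space M) {X i -` A \<inter> space M | A. A \<in> sets borel}) UNIV"
      using indep by (simp add: indep_vars_def)
    show "sigma_algebra (space M) (sigma_sets (space M) {X i -` A \<inter> space M | A. A \<in> sets borel})" for i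
      by (rule sigma_algebra_sigma_sets) auto
  qed
  ultimately have "prob {x \<in> space M. \<forall>K::nat. \<exists>n. K < (\<Sum>i<n. X i x)} = 1" by simp
  then have "AE x in M. \<forall>K::nat. \<exists>n. K < (\<Sum>i<n. X i x)"
    by (subst (asm) prob_Collect_eq_1) auto
  then show ?thesis
  proof (rule AE_mp, intro AE_I2 impI allI)
    fix x and K :: real assume *: "\<forall>K::nat. \<exists>n. K < (\<Sum>i<n. X i x)"
    obtain k :: nat where "K < real k" using reals_Archimedean2 by blast
    then show "\<exists>n. K < (\<Sum>i<n. X i x)" using * by (meson less_trans)
  qed
qed

end

section \<open>Measurability of the opinions and the almost sure statement\<close>

lemma HK_measurable:
  assumes \<xi>: "\<And>t. t \<ge> 1 \<Longrightarrow> \<xi> t \<in> borel_measurable M"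
  shows "(\<lambda>\<omega>. HK n \<epsilon> x0 (\<lambda>t. \<xi> t \<omega>) t i) \<in> borel_measurable M"
proof (induction t arbitrary: i)
  case 0
  then show ?case by simp
next
  case (Suc t)
  note [measurable] = Suc \<xi>[of "Suc t", simplified]
  define y where "y \<omega> = HK n \<epsilon> x0 (\<lambda>t. \<xi> t \<omega>) t" for \<omega>
  have [measurable]: "(\<lambda>\<omega>. y \<omega> j) \<in> borel_measurable M" for j unfolding y_def by (rule Suc)
  \<comment> \<open>The neighbour set varies with the noise; a conditional sum over the fixed set
    \<open>{1..n}\<close> is visibly measurable.\<close>
  have ind: "(\<Sum>j\<in>neighbors n \<epsilon> z i. f j) = (\<Sum>j\<in>{1..n}. if \<bar>z j - z i\<bar> \<le> \<epsilon> then f j else 0)"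
    for z and f :: "nat \<Rightarrow> real"
    unfolding neighbors_def by (rule sum.inter_filter) simp
  have card: "real (card (neighbors n \<epsilon> z i)) = (\<Sum>j\<in>neighbors n \<epsilon> z i. 1)" for z by simp
  have "(\<lambda>\<omega>. (\<Sum>j\<in>neighbors n \<epsilon> (y \<omega>) i. y \<omega> j) / real (card (neighbors n \<epsilon> (y \<omega>) i))
      + (if i = 1 then \<xi> (Suc t) \<omega> else 0)) \<in> borel_measurable M"
    unfolding card ind by measurable
  then show ?case by (simp add: y_def)
qed

theorem theorem3p1:
  fixes M :: "'a measure"
    and \<xi> :: "nat \<Rightarrow> 'a \<Rightarrow> real"
    and n Nc :: nat
    and \<epsilon> \<delta>\<^sub>1 \<delta>\<^sub>2 :: real
    and V :: "nat \<Rightarrow> nat set"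
    and xs x0 :: "nat \<Rightarrow> real"
  assumes "prob_space M"
    and "\<epsilon> > 0"
    and "divisive n \<epsilon> Nc V xs x0"
    and "0 \<le> \<delta>\<^sub>1" and "\<delta>\<^sub>1 \<le> \<delta>\<^sub>2"
    and "0 < \<delta>\<^sub>2" and "\<delta>\<^sub>2 \<le> \<epsilon> / (2 * real n)"
    and "prob_space.indep_vars M (\<lambda>_. borel) \<xi> {1..}"
    and "\<And>t. t \<ge> 1 \<Longrightarrow> distr M borel (\<xi> t) = uniform_measure lborel {-\<delta>\<^sub>1..\<delta>\<^sub>2}"
  shows "measure M {\<omega> \<in> space M.
           consensus_time n \<delta>\<^sub>2 (HK n \<epsilon> x0 (\<lambda>t. \<xi> t \<omega>)) < \<infinity>} = 1"
proof -
  interpret prob_space M by fact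
  have n: "1 \<le> n" using assms(3) by (auto simp: divisive_def)
  have rv: "\<xi> t \<in> borel_measurable M" if "t \<ge> 1" for t
    using assms(8) that by (simp add: indep_vars_def2)
  \<comment> \<open>Noise is read from time 1 on, while partial sums are indexed from 0.\<close>
  define X where "X i = \<xi> (Suc i)" for i
  have [measurable]: "random_variable borel (X i)" for i unfolding X_def by (rule rv) simp
  have lt: "-\<delta>\<^sub>1 < \<delta>\<^sub>2" using assms(4,6) by linarith
  have distr: "distr M borel (X i) = uniform_measure lborel {-\<delta>\<^sub>1..\<delta>\<^sub>2}" for i
    unfolding X_def by (rule assms(9)) simp
  \<comment> \<open>As a density with respect to \<open>lborel\<close>, the law matches the standard
    mean and variance formulas for the uniform distribution.\<close>
  have D: "distributed M lborel (X i) (\<lambda>x. indicator {-\<delta>\<^sub>1..\<delta>\<^sub>2} x / measure lborel {-\<delta>\<^sub>1..\<delta>\<^sub>2})" for i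
  proof -
    have "distr M lborel (X i) = density lborel (\<lambda>x. indicator {-\<delta>\<^sub>1..\<delta>\<^sub>2} x / emeasure lborel {-\<delta>\<^sub>1..\<delta>\<^sub>2})"
      using distr[of i] by (simp add: uniform_measure_def cong: distr_cong)
    also have "\<dots> = density lborel (\<lambda>x. ennreal (indicator {-\<delta>\<^sub>1..\<delta>\<^sub>2} x / measure lborel {-\<delta>\<^sub>1..\<delta>\<^sub>2}))"
      using lt by (intro density_cong) (auto simp: indicator_def divide_ennreal[symmetric] simp flip: ennreal_1)
    finally show ?thesis by (simp add: distributed_def)
  qed
  have bounded: "AE \<omega> in M. X i \<omega> \<in> {-\<delta>\<^sub>1..\<delta>\<^sub>2}" for i
  proof -
    have "AE x in distr M borel (X i). x \<in> {-\<delta>\<^sub>1..\<delta>\<^sub>2}"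
      unfolding distr by (rule AE_uniform_measureI) auto
    then show ?thesis by (subst (asm) AE_distr_iff) auto
  qed
  have indep: "indep_vars (\<lambda>_. borel) X UNIV"
  proof -
    have "indep_vars (\<lambda>_. borel) \<xi> (range Suc)"
      using assms(8) by (rule indep_vars_subset) auto
    then show ?thesis
      unfolding X_def using indep_vars_reindex_inj[of Suc UNIV "\<lambda>_. borel" \<xi>] by simp
  qed
  have "AE \<omega> in M. \<forall>K. \<exists>n. K < (\<Sum>i<n. X i \<omega>)"
  proof (rule AE_partial_sums_unbounded[OF indep _ _ _ _ _ distr])
    show "expectation (X i) = (-\<delta>\<^sub>1 + \<delta>\<^sub>2) / 2" for i
      by (rule uniform_distributed_expectation[OF D])
    show "0 \<le> (-\<delta>\<^sub>1 + \<delta>\<^sub>2) / 2" using assms(5) by simp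
    show "0 < (\<delta>\<^sub>2 - (-\<delta>\<^sub>1)) / sqrt 12" using lt by simp
    show "variance (X i) = ((\<delta>\<^sub>2 - (-\<delta>\<^sub>1)) / sqrt 12)\<^sup>2" for i
      using uniform_distributed_variance[OF D] by (simp add: power_divide)
    show "integrable M (\<lambda>x. (X i x)\<^sup>2)" for i
    proof (rule integrable_const_bound[of _ "\<delta>\<^sub>2\<^sup>2"])
      show "AE x in M. norm ((X i x)\<^sup>2) \<le> \<delta>\<^sub>2\<^sup>2"
        using bounded[of i]
      proof eventually_elim
        case (elim x)
        then have "\<bar>X i x\<bar> \<le> \<bar>\<delta>\<^sub>2\<bar>" using assms(5) by (auto simp: abs_le_iff)
        then show ?case by (simp add: abs_le_square_iff)
      qed
    qed measurable
  qed
  \<comment> \<open>There are countably many times, so all noise bounds hold at once outside a null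
    set.\<close>
  moreover have "AE \<omega> in M. \<forall>i. X i \<omega> \<in> {-\<delta>\<^sub>1..\<delta>\<^sub>2}"
    using bounded by (simp add: AE_all_countable)
  ultimately have "AE \<omega> in M. consensus_time n \<delta>\<^sub>2 (HK n \<epsilon> x0 (\<lambda>t. \<xi> t \<omega>)) < \<infinity>"
  proof eventually_elim
    case (elim \<omega>)
    interpret HK_path n Nc \<epsilon> \<delta>\<^sub>2 V xs x0 "\<lambda>t. \<xi> t \<omega>"
    proof
      \<comment> \<open>Since \<open>\<delta>\<^sub>1 \<le> \<delta>\<^sub>2\<close>, the asymmetric
        interval lies within the symmetric bound of the locale.\<close>
      show "\<bar>\<xi> t \<omega>\<bar> \<le> \<delta>\<^sub>2" if "t \<ge> 1" for t
        using elim(2)[rule_format, of "t - 1"] that assms(5) by (simp add: X_def abs_le_iff)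
    qed (use assms in auto)
    show ?case using elim(1) by (intro consensus_reached) (simp add: X_def)
  qed
  moreover have "{\<omega> \<in> space M. consensus_time n \<delta>\<^sub>2 (HK n \<epsilon> x0 (\<lambda>t. \<xi> t \<omega>)) < \<infinity>} \<in> events"
  proof -
    note [measurable] = HK_measurable[OF rv]
    show ?thesis unfolding consensus_time_finite_iff diam_le_iff[OF n] by measurable
  qed
  ultimately show ?thesis by (subst prob_Collect_eq_1)
qed

end
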